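(* (i) For every odd $k$, the optimal deterministic competitive ratio for One-out-of-$m$ Paging with $k$ slots and $m=(k+1)/2$ is at least $\binom{k}{m}=\Omega(2^k/\sqrt{k})$. For every $k$, the optimal deterministic competitive ratio for One-out-of-$m$ Paging with $k$ slots and $m=\lfloor (k+1)/2\rfloor$ is $\Omega(2^k/\sqrt{k})$. (ii) For every even $m\ge 2$ and every $k>m$ that is an odd multiple of $m-1$, the optimal deterministic competitive ratio for One-out-of-$m$ Paging with $k$ slots is at least $\binom{m-1}{m/2}\left(\frac{k}{m-1}\right)^{m/2}=\Theta\big((4k/m)^{m/2}/\sqrt{m}\big)=\Omega\big(\sqrt{|\mathcal{F}|}\big)$, where $\mathcal{F}=\binom{[k]}{m}$.
   Context: Slot-Heterogenous Paging: cache slots $[k]$, a family $\mathcal{F}\subseteq 2^{[k]}\setminus\{\emptyset\}$ of requestable slot sets, and requests $(p,S)$ with $p$ a page and $S\in\mathcal{F}$. A configuration assigns to each slot a single page or nothing and satisfies $(p,S)$ if some slot in $S$ holds $p$. A solution is a sequence of configurations $C_1,\dots,C_T$ with $C_t$ satisfying the $t$-th request; its cost is the number of retrievals (page $p$ is retrieved in slot $s$ at time $t$ if $C_t$ assigns $p$ to $s$ but $C_{t-1}$ does not, or $t=1$). A deterministic online algorithm is $c$-competitive if its cost is at most $c\cdot\mathrm{OPT}(\sigma)+b$ for every request sequence $\sigma$, for a constant $b$ independent of $\sigma$; the optimal deterministic competitive ratio is the infimum of such $c$ over deterministic online algorithms. One-out-of-$m$ Paging is Slot-Heterogenous Paging with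 $\mathcal{F}=\binom{[k]}{m}=\{S\subseteq[k]: |S|=m\}$. *)

theory Defs
  imports Complex_Main "HOL-Library.Extended_Real" "HOL-Library.Landau_Symbols"
begin

text \<open>The cache slots are \<open>{1..k}\<close>. Pages come from an infinite universe, represented by the
  natural numbers.\<close>

type_synonym slot = nat
type_synonym page = nat
type_synonym request = "page \<times> slot set"
type_synonym config = "slot \<rightharpoonup> page"

definition is_config :: "nat \<Rightarrow> config \<Rightarrow> bool" where
  "is_config k C \<longleftrightarrow> dom C \<subseteq> {1..k}"

definition satisfies :: "config \<Rightarrow> request \<Rightarrow> bool" where
  "satisfies C r \<longleftrightarrow> (\<exists>s\<in>snd r. C s = Some (fst r))"

definition request_seqs :: "slot set set \<Rightarrow> request list set" where
  "request_seqs F = {\<sigma>. \<forall>r\<in>set \<sigma>. snd r \<in> F}"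

definition is_solution :: "nat \<Rightarrow> request list \<Rightarrow> config list \<Rightarrow> bool" where
  "is_solution k \<sigma> Cs \<longleftrightarrow> length Cs = length \<sigma> \<and>
     (\<forall>t<length \<sigma>. is_config k (Cs ! t) \<and> satisfies (Cs ! t) (\<sigma> ! t))"

text \<open>Time is 0-based here: index \<open>t\<close> is the time step \<open>t + 1\<close>.\<close>

definition retrievals :: "config list \<Rightarrow> nat \<Rightarrow> (page \<times> slot) set" where
  "retrievals Cs t =
     {(p, s). (Cs ! t) s = Some p \<and> (t = 0 \<or> (Cs ! (t - 1)) s \<noteq> Some p)}"

definition cost :: "config list \<Rightarrow> nat" where
  "cost Cs = (\<Sum>t<length Cs. card (retrievals Cs t))"

definition OPT :: "nat \<Rightarrow> request list \<Rightarrow> nat" where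
  "OPT k \<sigma> = Inf {cost Cs | Cs. is_solution k \<sigma> Cs}"

text \<open>A deterministic online algorithm maps the requests seen so far to the current
  configuration.\<close>

type_synonym algorithm = "request list \<Rightarrow> config"

definition run :: "algorithm \<Rightarrow> request list \<Rightarrow> config list" where
  "run A \<sigma> = map (\<lambda>t. A (take (Suc t) \<sigma>)) [0..<length \<sigma>]"

definition online_algorithm :: "nat \<Rightarrow> slot set set \<Rightarrow> algorithm \<Rightarrow> bool" where
  "online_algorithm k F A \<longleftrightarrow> (\<forall>\<sigma>\<in>request_seqs F. is_solution k \<sigma> (run A \<sigma>))"

definition competitive :: "nat \<Rightarrow> slot set set \<Rightarrow> real \<Rightarrow> algorithm \<Rightarrow> bool" where
  "competitive k F c A \<longleftrightarrow>
     (\<exists>b::real. \<forall>\<sigma>\<in>request_seqs F. real (cost (run A \<sigma>)) \<le> c * real (OPT k \<sigma>) + b)"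

text \<open>The infimum is taken in the extended reals, so that it would be \<open>\<infinity>\<close> (rather than
  unspecified) if no algorithm were competitive.\<close>

definition det_ratio :: "nat \<Rightarrow> slot set set \<Rightarrow> ereal" where
  "det_ratio k F = Inf {ereal c | c. \<exists>A. online_algorithm k F A \<and> competitive k F c A}"

definition one_out_of :: "nat \<Rightarrow> nat \<Rightarrow> slot set set" where
  "one_out_of m k = {S. S \<subseteq> {1..k} \<and> card S = m}"

definition admissible :: "(nat \<times> nat) set" where
  "admissible = {(m, k). even m \<and> 2 \<le> m \<and> m < k \<and> (\<exists>j. odd j \<and> k = j * (m - 1))}"

end

theory Submission
  imports Defs "HOL-Library.FuncSet"
begin

text \<open>
  Let \<open>Z\<close> be a family of requestable sets that has no proper 2-colouring, such that every
  \<open>S \<in> Z\<close> is the only monochromatic member of \<open>Z\<close> in some 2-colouring of the slots. With only two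
  pages, \<^emph>\<open>every\<close> configuration violates some request with a set from \<open>Z\<close>, so the adversary
  makes the algorithm pay at least 1 for each request. Offline, there are \<open>2 |Z|\<close> critical
  configurations, and each request violates exactly one of them. Staying in a fixed critical
  configuration, and changing one slot and changing it back whenever its request occurs, costs 2
  per occurrence. Averaging over all of them, the optimum for \<open>T\<close> requests is at most
  \<open>k + T / |Z|\<close>, so the ratio is at least \<open>|Z|\<close>.

  For (i), \<open>Z\<close> consists of all \<open>m\<close>-subsets of \<open>2 m - 1\<close> slots. For (ii), the slots are split into
  \<open>m - 1\<close> cycles of odd length, and a member of \<open>Z\<close> is a union of \<open>m / 2\<close> edges from different
  cycles: each cycle has a monochromatic edge, and some colour is taken by \<open>m / 2\<close> of these.
\<close>

section \<open>Counting retrievals\<close>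

lemma retrievals_subset_singleton:
  assumes "0 < t" and "\<And>s. s \<noteq> s0 \<Longrightarrow> (Cs ! t) s = (Cs ! (t - 1)) s"
  shows "retrievals Cs t \<subseteq> {(the ((Cs ! t) s0), s0)}"
proof clarify
  fix p s assume "(p, s) \<in> retrievals Cs t"
  then have "(Cs ! t) s = Some p" "(Cs ! (t - 1)) s \<noteq> Some p"
    using assms(1) by (auto simp: retrievals_def)
  then show "p = the ((Cs ! t) s0) \<and> s = s0"
    using assms(2)[of s] by (cases "s = s0") auto
qed

lemma card_retrievals_le:
  assumes "is_config k (Cs ! t)"
  shows "finite (retrievals Cs t)" and "card (retrievals Cs t) \<le> k"
proof -
  have sub: "retrievals Cs t \<subseteq> (\<lambda>s. (the ((Cs ! t) s), s)) ` {1..k}"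
    using assms unfolding retrievals_def is_config_def by force
  show "finite (retrievals Cs t)"
    using finite_subset[OF sub] by simp
  show "card (retrievals Cs t) \<le> k"
    using order_trans[OF card_mono[OF _ sub] card_image_le] by simp
qed

lemma OPT_le_cost: "is_solution k \<sigma> Cs \<Longrightarrow> OPT k \<sigma> \<le> cost Cs"
  unfolding OPT_def by (rule cInf_lower) auto

text \<open>After division by \<open>n\<close>, the term \<open>d / n\<close> vanishes in the limit;
  this disposes of the additive constant of competitiveness.\<close>

lemma le_of_linear_bound:
  fixes a c d :: real
  assumes "\<And>n. a * real n \<le> c * real n + d"
  shows "a \<le> c"
proof (rule ccontr)
  assume "\<not> a \<le> c"
  then have pos: "0 < a - c" by simp
  obtain n where "d < real n * (a - c)"
    using reals_Archimedean3[OF pos] by blast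
  then show False using assms[of n] by (simp add: algebra_simps)
qed

section \<open>Lower bound from critical hypergraphs\<close>

text \<open>The first configuration costs at most \<open>k\<close>. Later steps cost at most 1, and
  only on entering or leaving \<open>Y\<close>, so each occurrence of \<open>q\<close> pays for one
  entry and one exit.\<close>

lemma cost_detour_le:
  assumes "is_config k X" "is_config k Y" and "\<And>s. s \<noteq> s0 \<Longrightarrow> Y s = X s"
  shows "cost (map (\<lambda>r. if r = q then Y else X) \<sigma>)
           \<le> k + 2 * (\<Sum>t<length \<sigma>. of_bool (\<sigma> ! t = q))"
proof -
  define Cs where "Cs = map (\<lambda>r. if r = q then Y else X) \<sigma>"
  define a :: "nat \<Rightarrow> nat" where "a t = of_bool (\<sigma> ! t = q)" for t
  have step: "card (retrievals Cs (Suc t)) \<le> a t + a (Suc t)" if "Suc t < length \<sigma>" for t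
  proof (cases "\<sigma> ! t = q \<or> \<sigma> ! Suc t = q")
    case True
    have "retrievals Cs (Suc t) \<subseteq> {(the ((Cs ! Suc t) s0), s0)}"
      using that assms(3) by (intro retrievals_subset_singleton) (auto simp: Cs_def)
    then have "card (retrievals Cs (Suc t)) \<le> 1"
      using card_mono[of "{(the ((Cs ! Suc t) s0), s0)}"] by simp
    then show ?thesis using True by (auto simp: a_def)
  next
    case False
    then have "retrievals Cs (Suc t) = {}"
      using that by (auto simp: retrievals_def Cs_def)
    then show ?thesis by simp
  qed
  \<comment> \<open>The extra summand on the left reserves the charge for leaving \<open>Y\<close>
    after the last step counted, so that the induction closes.\<close>
  have "(\<Sum>t<n. card (retrievals Cs t)) + (if n = 0 then 0 else a (n - 1)) \<le> k + 2 * (\<Sum>t<n. a t)"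
    if "n \<le> length \<sigma>" for n
    using that
  proof (induction n)
    case 0
    then show ?case by simp
  next
    case (Suc n)
    show ?case
    proof (cases n)
      case 0
      have "is_config k (Cs ! 0)"
        using assms Suc.prems by (subst Cs_def, subst nth_map) auto
      then show ?thesis using card_retrievals_le(2)[of k Cs 0] 0 by simp
    next
      case (Suc n')
      then show ?thesis
        using Suc.IH Suc.prems step[of n'] by simp
    qed
  qed
  from this[of "length \<sigma>"] show ?thesis
    by (simp add: cost_def Cs_def a_def split: if_splits)
qed

text \<open>The requested page is in a requested slot after the request but not before, so it is
  retrieved; at index 0 every page held counts as retrieved.\<close>

lemma length_le_cost_run:
  assumes alg: "online_algorithm k F A" and \<sigma>: "\<sigma> \<in> request_seqs F"
    and unsat: "\<And>t. t < length \<sigma> \<Longrightarrow> \<not> satisfies (A (take t \<sigma>)) (\<sigma> ! t)"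
  shows "length \<sigma> \<le> cost (run A \<sigma>)"
proof -
  have sol: "is_solution k \<sigma> (run A \<sigma>)"
    using alg \<sigma> by (simp add: online_algorithm_def)
  have "1 \<le> card (retrievals (run A \<sigma>) t)" if t: "t < length \<sigma>" for t
  proof -
    have "satisfies (run A \<sigma> ! t) (\<sigma> ! t)" "is_config k (run A \<sigma> ! t)"
      using sol t by (auto simp: is_solution_def)
    then obtain s where s: "s \<in> snd (\<sigma> ! t)" "(run A \<sigma> ! t) s = Some (fst (\<sigma> ! t))"
      by (auto simp: satisfies_def)
    have "run A \<sigma> ! (t - 1) = A (take t \<sigma>)" if "t \<noteq> 0"
      using t that by (simp add: run_def less_imp_diff_less)
    then have "(fst (\<sigma> ! t), s) \<in> retrievals (run A \<sigma>) t"
      using s unsat[OF t] by (auto simp: retrievals_def satisfies_def)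
    moreover have "finite (retrievals (run A \<sigma>) t)"
      using card_retrievals_le(1) \<open>is_config k (run A \<sigma> ! t)\<close> by blast
    ultimately show ?thesis
      by (metis One_nat_def Suc_leI card_gt_0_iff empty_iff)
  qed
  then have "(\<Sum>t<length \<sigma>. 1) \<le> (\<Sum>t<length \<sigma>. card (retrievals (run A \<sigma>) t))"
    by (intro sum_mono) auto
  then show ?thesis by (simp add: cost_def run_def)
qed

text \<open>Determinism lets the adversary evaluate \<open>A\<close> on the requests so far and ask
  next for whatever that configuration violates.\<close>

fun adversary :: "(config \<Rightarrow> request) \<Rightarrow> algorithm \<Rightarrow> nat \<Rightarrow> request list" where
  "adversary violated A 0 = []"
| "adversary violated A (Suc n) =
     adversary violated A n @ [violated (A (adversary violated A n))]"

lemma length_adversary [simp]: "length (adversary violated A n) = n"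
  by (induction n) auto

lemma take_adversary: "t \<le> n \<Longrightarrow> take t (adversary violated A n) = adversary violated A t"
  by (induction n) (auto simp: le_Suc_eq)

lemma nth_adversary:
  "t < n \<Longrightarrow> adversary violated A n ! t = violated (A (adversary violated A t))"
  by (induction n) (auto simp: nth_append less_Suc_eq)

text \<open>The critical configuration of a request \<open>(b, S)\<close> is the colouring \<open>X\<close> of \<open>crit\<close> with
  page \<open>1 - b\<close> on \<open>X\<close> and page \<open>b\<close> elsewhere.\<close>

theorem card_le_det_ratio:
  assumes ZF: "Z \<subseteq> F" and fin: "finite Z" and slots: "\<And>S. S \<in> Z \<Longrightarrow> S \<subseteq> {1..k} \<and> S \<noteq> {}"
    and mono: "\<And>X. \<exists>S\<in>Z. S \<subseteq> X \<or> S \<inter> X = {}"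
    and crit: "\<And>S. S \<in> Z \<Longrightarrow> \<exists>X. S \<subseteq> X \<and> (\<forall>T\<in>Z. T \<noteq> S \<longrightarrow> \<not> T \<subseteq> X \<and> T \<inter> X \<noteq> {})"
  shows "ereal (real (card Z)) \<le> det_ratio k F"
proof -
  define Q :: "request set" where "Q = {0, 1} \<times> Z"
  have finQ: "finite Q" and cardQ: "card Q = 2 * card Z"
    using fin by (auto simp: Q_def card_cartesian_product)

  \<comment> \<open>Slots are coloured by whether they hold page 1: a set within that class cannot
    serve page 0, a set disjoint from it cannot serve page 1.\<close>
  have "\<exists>r\<in>Q. \<not> satisfies C r" for C
  proof -
    obtain S where S: "S \<in> Z" "S \<subseteq> {s. C s = Some 1} \<or> S \<inter> {s. C s = Some 1} = {}"
      using mono by blast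
    then have "\<not> satisfies C (0, S) \<or> \<not> satisfies C (1, S)"
      by (auto simp: satisfies_def)
    then show ?thesis using S(1) by (auto simp: Q_def)
  qed
  then obtain violated where violated: "\<And>C. violated C \<in> Q" "\<And>C. \<not> satisfies C (violated C)"
    by metis

  have opt: "OPT k \<sigma> \<le> k + 2 * (\<Sum>t<length \<sigma>. of_bool (\<sigma> ! t = q))"
    if q: "q \<in> Q" and \<sigma>: "set \<sigma> \<subseteq> Q" for q \<sigma>
  proof -
    obtain b S where bS: "q = (b, S)" "b \<in> {0, 1}" "S \<in> Z"
      using q by (auto simp: Q_def)
    obtain X where X: "S \<subseteq> X" "\<forall>T\<in>Z. T \<noteq> S \<longrightarrow> \<not> T \<subseteq> X \<and> T \<inter> X \<noteq> {}"
      using crit bS(3) by blast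
    obtain s0 where s0: "s0 \<in> S" "s0 \<in> {1..k}"
      using slots[OF bS(3)] by blast
    define C :: config where
      "C = (\<lambda>s. if s \<in> {1..k} then Some (if s \<in> X then 1 - b else b) else None)"
    \<comment> \<open>Page \<open>b\<close> needs a slot of \<open>T\<close> outside
      \<open>X\<close>, the other page a slot inside \<open>X\<close>. The other page is served on
      \<open>S\<close> itself because \<open>S\<close> is nonempty and within
      \<open>X\<close>.\<close>
    have C: "satisfies C r" if r: "r \<in> Q" "r \<noteq> q" for r
    proof -
      obtain b' T where r': "r = (b', T)" "b' \<in> {0, 1}" "T \<in> Z"
        using r(1) by (auto simp: Q_def)
      have T: "T \<subseteq> {1..k}" "T \<noteq> {}" using slots r'(3) by auto
      show ?thesis
      proof (cases "b' = b")
        case True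
        then have "\<not> T \<subseteq> X" using r' r(2) bS(1) X(2) by auto
        then obtain s where "s \<in> T" "s \<notin> X" by blast
        then show ?thesis
          using T True r' by (auto simp: satisfies_def C_def intro!: bexI[of _ s])
      next
        case False
        have "T \<inter> X \<noteq> {}" using X T r'(3) by (cases "T = S") auto
        then obtain s where "s \<in> T" "s \<in> X" by blast
        then show ?thesis
          using T False r' bS(2) by (auto simp: satisfies_def C_def intro!: bexI[of _ s])
      qed
    qed
    have conf: "is_config k C" "is_config k (C(s0 \<mapsto> b))"
      using s0 by (auto simp: is_config_def C_def split: if_splits)
    have "satisfies (C(s0 \<mapsto> b)) q"
      using s0 bS by (auto simp: satisfies_def)
    moreover have "satisfies C (\<sigma> ! t)" if "t < length \<sigma>" "\<sigma> ! t \<noteq> q" for t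
      using C \<sigma> that nth_mem by blast
    ultimately have "is_solution k \<sigma> (map (\<lambda>r. if r = q then C(s0 \<mapsto> b) else C) \<sigma>)"
      using conf by (auto simp: is_solution_def)
    then have "OPT k \<sigma> \<le> cost (map (\<lambda>r. if r = q then C(s0 \<mapsto> b) else C) \<sigma>)"
      by (rule OPT_le_cost)
    also have "\<dots> \<le> k + 2 * (\<Sum>t<length \<sigma>. of_bool (\<sigma> ! t = q))"
      by (rule cost_detour_le[where ?s0.0 = s0]) (use conf in auto)
    finally show ?thesis .
  qed

  \<comment> \<open>Summed over \<open>Q\<close>, every request of \<open>\<sigma>\<close> is
    counted for exactly one \<open>q\<close>. The factor 2 of the detours cancels against
    \<open>card Q = 2 * card Z\<close>.\<close>
  have avg: "card Z * OPT k \<sigma> \<le> card Z * k + length \<sigma>" if \<sigma>: "set \<sigma> \<subseteq> Q" for \<sigma>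
  proof -
    have "(\<Sum>q\<in>Q. OPT k \<sigma>) \<le> (\<Sum>q\<in>Q. k + 2 * (\<Sum>t<length \<sigma>. of_bool (\<sigma> ! t = q)))"
      using opt \<sigma> by (intro sum_mono) auto
    also have "\<dots> = card Q * k + 2 * (\<Sum>q\<in>Q. \<Sum>t<length \<sigma>. of_bool (\<sigma> ! t = q))"
      by (simp add: sum.distrib sum_distrib_left)
    also have "(\<Sum>q\<in>Q. \<Sum>t<length \<sigma>. of_bool (\<sigma> ! t = q))
                 = (\<Sum>t<length \<sigma>. \<Sum>q\<in>Q. of_bool (\<sigma> ! t = q) :: nat)"
      by (rule sum.swap)
    also have "\<dots> = (\<Sum>t<length \<sigma>. 1)"
    proof (rule sum.cong)
      fix t assume "t \<in> {..<length \<sigma>}"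
      then have "\<sigma> ! t \<in> Q" using \<sigma> by auto
      then show "(\<Sum>q\<in>Q. of_bool (\<sigma> ! t = q) :: nat) = 1"
        using finQ by (simp add: of_bool_def)
    qed simp
    finally show ?thesis by (simp add: cardQ)
  qed

  show ?thesis unfolding det_ratio_def
  proof (rule Inf_greatest, clarsimp)
    fix c A assume alg: "online_algorithm k F A" and "competitive k F c A"
    then obtain b where b: "\<And>\<sigma>. \<sigma> \<in> request_seqs F \<Longrightarrow> real (cost (run A \<sigma>)) \<le> c * real (OPT k \<sigma>) + b"
      by (auto simp: competitive_def)
    have bound: "real n \<le> c * real (OPT k (adversary violated A n)) + b"
      and setQ: "set (adversary violated A n) \<subseteq> Q" for n
    proof -
      let ?\<sigma> = "adversary violated A n"
      show setQ: "set ?\<sigma> \<subseteq> Q"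
        using violated(1) by (induction n) auto
      then have seq: "?\<sigma> \<in> request_seqs F"
        using ZF by (auto simp: request_seqs_def Q_def)
      have "length ?\<sigma> \<le> cost (run A ?\<sigma>)"
        using alg seq by (rule length_le_cost_run) (simp add: take_adversary nth_adversary violated(2))
      then show "real n \<le> c * real (OPT k ?\<sigma>) + b"
        using b[OF seq] by simp
    qed
    show "real (card Z) \<le> c"
    \<comment> \<open>\<open>c\<close> ranges over all reals, and \<open>avg\<close> can be
      multiplied by \<open>c\<close> only if \<open>c\<close> is nonnegative. A negative
      \<open>c\<close> would give \<open>n \<le> b\<close> for every \<open>n\<close>.\<close>
    proof (cases "0 \<le> c")
      case True
      show ?thesis
      proof (rule le_of_linear_bound)
        fix n
        let ?o = "OPT k (adversary violated A n)"
        have "real (card Z * ?o) \<le> real (card Z * k + n)"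
          using avg[OF setQ[of n]] of_nat_mono by fastforce
        then have "c * (real (card Z) * ?o) \<le> c * (real (card Z) * k + n)"
          using True by (intro mult_left_mono) auto
        moreover have "real (card Z) * n \<le> real (card Z) * (c * ?o + b)"
          using bound[of n] by (intro mult_left_mono) auto
        ultimately show "real (card Z) * n \<le> c * n + (c * card Z * k + card Z * b)"
          by (simp add: algebra_simps)
      qed
    next
      case False
      have "real n \<le> b" for n
        using bound[of n] False by (smt (verit) mult_nonneg_nonneg mult_minus_left of_nat_0_le_iff)
      then show ?thesis using reals_Archimedean2[of b] by (meson linorder_not_le)
    qed
  qed
qed

section \<open>All \<open>m\<close>-subsets of \<open>2 m - 1\<close> slots\<close>

text \<open>Of \<open>2 m - 1\<close> slots, one of the two colours takes at least \<open>m\<close>.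
  Confining the family to these slots lets \<open>k\<close> be larger, which covers even
  \<open>k = 2 m\<close>.\<close>

lemma binomial_le_det_ratio:
  assumes "1 \<le> m" "2 * m - 1 \<le> k"
  shows "ereal (real ((2 * m - 1) choose m)) \<le> det_ratio k (one_out_of m k)"
proof -
  let ?Z = "{S. S \<subseteq> {1..2 * m - 1} \<and> card S = m}"
  have "ereal (real (card ?Z)) \<le> det_ratio k (one_out_of m k)"
  proof (rule card_le_det_ratio)
    show "?Z \<subseteq> one_out_of m k"
      using assms by (force simp: one_out_of_def)
    show "finite ?Z" by simp
    show "S \<subseteq> {1..k} \<and> S \<noteq> {}" if "S \<in> ?Z" for S
      using that assms by force
    show "\<exists>S\<in>?Z. S \<subseteq> X \<or> S \<inter> X = {}" for X
    proof -
      have "card ({1..2 * m - 1} \<inter> X) + card ({1..2 * m - 1} - X) = 2 * m - 1"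
        by (metis card_Int_Diff card_atLeastAtMost diff_Suc_1 finite_atLeastAtMost)
      then consider "m \<le> card ({1..2 * m - 1} \<inter> X)" | "m \<le> card ({1..2 * m - 1} - X)"
        by linarith
      then show ?thesis
      proof cases
        case 1
        then obtain S where "S \<subseteq> {1..2 * m - 1} \<inter> X" "card S = m"
          by (metis obtain_subset_with_card_n)
        then show ?thesis by blast
      next
        case 2
        then obtain S where "S \<subseteq> {1..2 * m - 1} - X" "card S = m"
          by (metis obtain_subset_with_card_n)
        then show ?thesis by blast
      qed
    qed
    \<comment> \<open>The critical colouring is \<open>X = S\<close>: no other
      \<open>m\<close>-subset fits into \<open>S\<close>, and the other \<open>m - 1\<close> slots
      are too few for one.\<close>
    show "\<exists>X. S \<subseteq> X \<and> (\<forall>T\<in>?Z. T \<noteq> S \<longrightarrow> \<not> T \<subseteq> X \<and> T \<inter> X \<noteq> {})" if S: "S \<in> ?Z" for S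
    proof (intro exI conjI ballI impI notI)
      fix T assume T: "T \<in> ?Z" "T \<noteq> S"
      have fin: "finite S" "finite T" using S T finite_subset by blast+
      show False if "T \<subseteq> S"
        using that T S card_subset_eq[OF fin(1) that] by simp
      show False if "T \<inter> S = {}"
      proof -
        have "card (T \<union> S) = 2 * m"
          using that fin S T by (simp add: card_Un_disjoint)
        moreover have "card (T \<union> S) \<le> card {1..2 * m - 1}"
          using S T by (intro card_mono) auto
        ultimately show False using assms by simp
      qed
    qed simp
  qed
  then show ?thesis by (simp add: n_subsets)
qed

section \<open>Unions of odd cycle edges\<close>

text \<open>Strict alternation ties the colour of \<open>i\<close> to its parity; as
  \<open>j - 1\<close> is even, the closing edge from \<open>j - 1\<close> to 0 would then join
  equal colours.\<close>

lemma odd_cycle_monochromatic_edge: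
  fixes P :: "nat \<Rightarrow> bool"
  assumes "odd j"
  shows "\<exists>i<j. P i = P (Suc i mod j)"
proof (rule ccontr)
  assume neq: "\<not> (\<exists>i<j. P i = P (Suc i mod j))"
  have "P i = (P 0 = even i)" if "i < j" for i
    using that
  proof (induction i)
    case (Suc i)
    then show ?case using neq[unfolded not_ex, rule_format, of i] by auto
  qed simp
  from this[of "j - 1"] neq[unfolded not_ex, rule_format, of "j - 1"] assms
  show False by (cases j) auto
qed

text \<open>The colouring of an odd cycle whose only monochromatic edge joins \<open>e\<close> to its successor.\<close>

definition cycle_colour :: "nat \<Rightarrow> nat \<Rightarrow> bool" where
  "cycle_colour e i \<longleftrightarrow> (even (i + e) \<longleftrightarrow> i \<le> e)"

lemma cycle_colour_self [simp]: "cycle_colour e e"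
  by (simp add: cycle_colour_def)

text \<open>From \<open>i\<close> to \<open>i + 1\<close> the parity flips, and the test
  \<open>i \<le> e\<close> flips only at \<open>i = e\<close>, where the two flips cancel. On the
  closing edge the parity stays, \<open>j - 1\<close> being even, so the colours agree only if
  \<open>j - 1 \<le> e\<close>.\<close>

lemma cycle_colour_edge_iff:
  assumes "odd j" "e < j" "i < j"
  shows "cycle_colour e i = cycle_colour e (Suc i mod j) \<longleftrightarrow> i = e"
proof (cases "Suc i = j")
  case True
  then show ?thesis using assms by (auto simp: cycle_colour_def)
next
  case False
  then have "Suc i mod j = Suc i" using assms by simp
  then show ?thesis by (auto simp: cycle_colour_def le_less Suc_le_eq)
qed

text \<open>The slots are split into blocks \<open>{g * j + 1..g * j + j}\<close>, each carrying a cycle of length \<open>j\<close>.\<close>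

definition block_slot :: "nat \<Rightarrow> nat \<times> nat \<Rightarrow> nat" where
  "block_slot j = (\<lambda>(g, i). Suc (g * j + i))"

text \<open>An edge is named by its first vertex, so \<open>f\<close> picks one edge from each cycle
  in \<open>G\<close>.\<close>

definition cycle_union :: "nat \<Rightarrow> nat set \<times> (nat \<Rightarrow> nat) \<Rightarrow> nat set" where
  "cycle_union j = (\<lambda>(G, f). block_slot j ` (SIGMA g:G. {f g, Suc (f g) mod j}))"

lemma inj_on_block_slot: "inj_on (block_slot j) (UNIV \<times> {..<j})"
proof (rule inj_on_inverseI)
  fix p :: "nat \<times> nat" assume "p \<in> UNIV \<times> {..<j}"
  then show "(\<lambda>s. ((s - 1) div j, (s - 1) mod j)) (block_slot j p) = p"
    by (auto simp: block_slot_def)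
qed

lemma block_slot_le:
  assumes "g < n" "i < j"
  shows "block_slot j (g, i) \<in> {1..j * n}"
proof -
  have "g * j + i < Suc g * j" using assms by simp
  also have "\<dots> \<le> n * j" using assms by (intro mult_le_mono1) auto
  finally show ?thesis by (simp add: block_slot_def mult.commute)
qed

lemma cycle_union_subset_iff:
  "cycle_union j (G, f) \<subseteq> X \<longleftrightarrow>
     (\<forall>g\<in>G. block_slot j (g, f g) \<in> X \<and> block_slot j (g, Suc (f g) mod j) \<in> X)"
  by (auto simp: cycle_union_def)

text \<open>For \<open>m = 2 * n\<close> there are \<open>m - 1\<close> cycles of length
  \<open>j = k / (m - 1)\<close>. A member of the family chooses \<open>n\<close> cycles and one of
  the \<open>j\<close> edges in each, whence the count.\<close>

lemma cycle_union_le_det_ratio: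
  assumes j: "odd j" "1 < j" and n: "1 \<le> n" and k: "k = j * (2 * n - 1)"
  shows "ereal (real (((2 * n - 1) choose n) * j ^ n)) \<le> det_ratio k (one_out_of (2 * n) k)"
proof -
  \<comment> \<open>Extensional functions carry no choice outside \<open>G\<close>, so each
    selection of edges has one index.\<close>
  define I where "I = (SIGMA G:{G. G \<subseteq> {..<2 * n - 1} \<and> card G = n}. G \<rightarrow>\<^sub>E {..<j})"
  have finG: "finite G" if "G \<subseteq> {..<2 * n - 1}" for G using that finite_subset by blast
  have finI: "finite I"
    unfolding I_def by (intro finite_SigmaI finite_PiE) (use finG in auto)
  have "card I = (\<Sum>G | G \<subseteq> {..<2 * n - 1} \<and> card G = n. card (G \<rightarrow>\<^sub>E {..<j}))"
    unfolding I_def by (intro card_SigmaI) (use finG in \<open>auto intro!: finite_PiE\<close>)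
  also have "\<dots> = (\<Sum>G | G \<subseteq> {..<2 * n - 1} \<and> card G = n. j ^ n)"
    by (intro sum.cong) (auto simp: card_PiE finG)
  finally have cardI: "card I = ((2 * n - 1) choose n) * j ^ n"
    by (simp add: n_subsets)

  have inter_iff: "cycle_union j a \<inter> X = {} \<longleftrightarrow> cycle_union j a \<subseteq> - X" for a X
    by blast

  have crit: "\<exists>X. cycle_union j a \<subseteq> X \<and>
      (\<forall>b\<in>I. b \<noteq> a \<longrightarrow> \<not> cycle_union j b \<subseteq> X \<and> cycle_union j b \<inter> X \<noteq> {})" if aI: "a \<in> I" for a
  proof -
    obtain G f where a: "a = (G, f)" "G \<subseteq> {..<2 * n - 1}" "card G = n" "f \<in> G \<rightarrow>\<^sub>E {..<j}"
      using aI by (cases a) (auto simp: I_def)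
    \<comment> \<open>Each cycle gets a single monochromatic edge: at \<open>f g\<close> and inside
      \<open>X\<close> for the \<open>n\<close> cycles in \<open>G\<close>, at 0 and outside
      \<open>X\<close> for the \<open>n - 1\<close> others.\<close>
    define col where "col g = (if g \<in> G then cycle_colour (f g) else Not \<circ> cycle_colour 0)" for g
    define X where "X = {s. col ((s - 1) div j) ((s - 1) mod j)}"
    have X: "block_slot j (g, i) \<in> X \<longleftrightarrow> col g i" if "i < j" for g i
      using that by (simp add: X_def block_slot_def)
    have next_less: "Suc i mod j < j" for i using j by simp
    have edge_in: "col g i = col g (Suc i mod j) \<longleftrightarrow> i = f g" if "g \<in> G" "i < j" for g i
      using that a(4) j cycle_colour_edge_iff[of j "f g" i] by (auto simp: col_def)
    have edge_out: "col g i = col g (Suc i mod j) \<longleftrightarrow> i = 0" if "g \<notin> G" "i < j" for g i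
      using that j cycle_colour_edge_iff[of j 0 i] by (auto simp: col_def)
    have self: "col g (f g)" if "g \<in> G" for g
      using that by (simp add: col_def)
    have out: "\<not> col g 0" if "g \<notin> G" for g
      using that by (simp add: col_def)
    show ?thesis
    proof (intro exI conjI ballI impI)
      have "f g < j" if "g \<in> G" for g using a(4) that by auto
      then show "cycle_union j a \<subseteq> X"
        unfolding a(1) cycle_union_subset_iff using X next_less edge_in self by blast
    next
      fix b assume b: "b \<in> I" "b \<noteq> a"
      obtain G' f' where b': "b = (G', f')" "G' \<subseteq> {..<2 * n - 1}" "card G' = n" "f' \<in> G' \<rightarrow>\<^sub>E {..<j}"
        using b by (cases b) (auto simp: I_def)
      have f': "f' g < j" if "g \<in> G'" for g using b'(4) that by auto
      show "\<not> cycle_union j b \<subseteq> X"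
      proof
        assume "cycle_union j b \<subseteq> X"
        then have *: "col g (f' g) \<and> col g (Suc (f' g) mod j)" if "g \<in> G'" for g
          unfolding b'(1) cycle_union_subset_iff using X next_less f' that by blast
        \<comment> \<open>Monochromatic edges inside \<open>X\<close> occur only in cycles of
          \<open>G\<close>, at \<open>f g\<close>; equal cardinalities then force
          \<open>G' = G\<close>.\<close>
        have **: "g \<in> G \<and> f' g = f g" if "g \<in> G'" for g
          using *[OF that] edge_in edge_out out f'[OF that] by metis
        then have "G' \<subseteq> G" by blast
        then have "G' = G" using a b' finG card_subset_eq by metis
        then have "f' = f" using ** a(4) b'(4) by (metis PiE_ext)
        then show False using \<open>G' = G\<close> b(2) a(1) b'(1) by simp
      qed
      show "cycle_union j b \<inter> X \<noteq> {}"
      proof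
        assume "cycle_union j b \<inter> X = {}"
        then have *: "\<not> col g (f' g) \<and> \<not> col g (Suc (f' g) mod j)" if "g \<in> G'" for g
          unfolding inter_iff b'(1) cycle_union_subset_iff using X next_less f' that by blast
        \<comment> \<open>A member avoiding \<open>X\<close> would need \<open>n\<close> cycles
          outside \<open>G\<close>, but only \<open>n - 1\<close> exist.\<close>
        have "g \<notin> G" if "g \<in> G'" for g
          using *[OF that] edge_in self f'[OF that] by metis
        then have "card (G' \<union> G) = 2 * n"
          using a b' finG by (subst card_Un_disjoint) auto
        moreover have "card (G' \<union> G) \<le> card {..<2 * n - 1}"
          using a b' by (intro card_mono) auto
        ultimately show False using n by simp
      qed
    qed
  qed
  \<comment> \<open>The critical colouring of \<open>a\<close> contains the set of \<open>a\<close>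
    but that of no other index.\<close>
  have "inj_on (cycle_union j) I"
    using crit by (intro inj_onI) (metis)
  then have card_eq: "card (cycle_union j ` I) = card I"
    by (rule card_image)

  have "ereal (real (card (cycle_union j ` I))) \<le> det_ratio k (one_out_of (2 * n) k)"
  proof (rule card_le_det_ratio)
    have *: "cycle_union j a \<subseteq> {1..k} \<and> card (cycle_union j a) = 2 * n" if aI: "a \<in> I" for a
    proof -
      obtain G f where a: "a = (G, f)" "G \<subseteq> {..<2 * n - 1}" "card G = n" "f \<in> G \<rightarrow>\<^sub>E {..<j}"
        using aI by (cases a) (auto simp: I_def)
      have f: "f g < j" "Suc (f g) mod j < j" if "g \<in> G" for g using a(4) that j by auto
      have "cycle_union j a \<subseteq> {1..k}"
        unfolding a(1) cycle_union_subset_iff k 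
        using f a(2) by (meson block_slot_le lessThan_iff subsetD)
      moreover have "f g \<noteq> Suc (f g) mod j" for g
      proof
        assume "f g = Suc (f g) mod j"
        then show False using j by (metis mod_Suc mod_mod_trivial n_not_Suc_n One_nat_def less_irrefl)
      qed
      then have "card (SIGMA g:G. {f g, Suc (f g) mod j}) = 2 * n"
        using a finG by (subst card_SigmaI) auto
      moreover have "inj_on (block_slot j) (SIGMA g:G. {f g, Suc (f g) mod j})"
        by (rule inj_on_subset[OF inj_on_block_slot]) (use f in auto)
      ultimately show ?thesis by (simp add: a(1) cycle_union_def card_image)
    qed
    show "cycle_union j ` I \<subseteq> one_out_of (2 * n) k"
      using * by (auto simp: one_out_of_def)
    show "finite (cycle_union j ` I)" using finI by simp
    show "S \<subseteq> {1..k} \<and> S \<noteq> {}" if "S \<in> cycle_union j ` I" for S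
      using that * n by fastforce
    show "\<exists>X. S \<subseteq> X \<and> (\<forall>T\<in>cycle_union j ` I. T \<noteq> S \<longrightarrow> \<not> T \<subseteq> X \<and> T \<inter> X \<noteq> {})"
      if "S \<in> cycle_union j ` I" for S
    proof -
      obtain a where a: "a \<in> I" "S = cycle_union j a" using \<open>S \<in> cycle_union j ` I\<close> by blast
      from crit[OF a(1)] show ?thesis unfolding a(2) by (elim ex_forward) auto
    qed
    show "\<exists>S\<in>cycle_union j ` I. S \<subseteq> X \<or> S \<inter> X = {}" for X
    proof -
      have "\<exists>i<j. (block_slot j (g, i) \<in> X) = (block_slot j (g, Suc i mod j) \<in> X)" for g
        using odd_cycle_monochromatic_edge[OF j(1), of "\<lambda>i. block_slot j (g, i) \<in> X"] .
      then obtain f where f: "\<And>g. f g < j"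
        "\<And>g. (block_slot j (g, f g) \<in> X) = (block_slot j (g, Suc (f g) mod j) \<in> X)"
        by metis
      define P where "P = {g. block_slot j (g, f g) \<in> X}"
      have "card ({..<2 * n - 1} \<inter> P) + card ({..<2 * n - 1} - P) = 2 * n - 1"
        by (metis card_Int_Diff card_lessThan finite_lessThan)
      then consider "n \<le> card ({..<2 * n - 1} \<inter> P)" | "n \<le> card ({..<2 * n - 1} - P)"
        by linarith
      then obtain G where G: "G \<subseteq> {..<2 * n - 1}" "card G = n" "G \<subseteq> P \<or> G \<inter> P = {}"
      proof cases
        case 1
        then obtain S where "S \<subseteq> {..<2 * n - 1} \<inter> P" "card S = n"
          by (metis obtain_subset_with_card_n)
        then show ?thesis using that by blast
      next
        case 2
        then obtain S where "S \<subseteq> {..<2 * n - 1} - P" "card S = n"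
          by (metis obtain_subset_with_card_n)
        then show ?thesis using that by blast
      qed
      have "(G, restrict f G) \<in> I"
        using G f(1) by (auto simp: I_def)
      moreover have "cycle_union j (G, restrict f G) \<subseteq> X \<or> cycle_union j (G, restrict f G) \<inter> X = {}"
        unfolding inter_iff cycle_union_subset_iff using G(3) f(2) by (auto simp: P_def)
      ultimately show ?thesis by blast
    qed
  qed
  then show ?thesis by (simp only: card_eq cardI)
qed

section \<open>Asymptotics\<close>

lemma central_binomial_Suc:
  "real (Suc n) * real ((2 * Suc n) choose Suc n) = 2 * real (2 * n + 1) * real ((2 * n) choose n)"
proof -
  have central: "real ((2 * m) choose m) = fact (2 * m) / (fact m * fact m)" for m
    by (subst binomial_fact) auto
  define x where "x = real (Suc n)"
  have "0 < x" by (simp add: x_def)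
  have "fact (2 * Suc n) = 2 * x * real (2 * n + 1) * fact (2 * n)"
    by (simp add: x_def algebra_simps)
  moreover have "fact (Suc n) = x * fact n" by (simp add: x_def)
  ultimately show ?thesis
    unfolding central using \<open>0 < x\<close> by (simp only: flip: x_def) (simp add: field_simps)
qed

text \<open>Squaring keeps the inductive steps rational. They come down to
  \<open>(2n + 1)(2n + 3) \<le> (2n + 2)^2\<close> and
  \<open>4n(n + 1) \<le> (2n + 1)^2\<close>.\<close>

lemma central_binomial_square_bounds:
  shows "real (2 * n + 1) * real ((2 * n) choose n) ^ 2 \<le> 16 ^ n"
    and "1 \<le> n \<Longrightarrow> 16 ^ n \<le> 4 * real n * real ((2 * n) choose n) ^ 2"
proof -
  define a where "a n = real ((2 * n) choose n) ^ 2" for n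
  have rec: "a (Suc n) = 4 * (2 * real n + 1) ^ 2 / (real n + 1) ^ 2 * a n" for n
  proof -
    have "real ((2 * Suc n) choose Suc n) = 2 * (2 * real n + 1) / (real n + 1) * real ((2 * n) choose n)"
      using central_binomial_Suc[of n] by (simp add: divide_simps algebra_simps)
    then show ?thesis by (simp only: a_def power_mult_distrib power_divide) simp
  qed
  have nonneg: "0 \<le> a n" for n by (simp add: a_def)
  have "real (2 * n + 1) * a n \<le> 16 ^ n"
  proof (induction n)
    case 0
    then show ?case by (simp add: a_def)
  next
    case (Suc n)
    have "real (2 * Suc n + 1) * a (Suc n)
        = 4 * (2 * real n + 1) * (2 * real n + 3) / (real n + 1) ^ 2 * (real (2 * n + 1) * a n)"
      unfolding rec by (simp add: power2_eq_square algebra_simps)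
    also have "\<dots> \<le> 16 * (real (2 * n + 1) * a n)"
    proof (rule mult_right_mono)
      have "4 * (2 * real n + 1) * (2 * real n + 3) \<le> 16 * (real n + 1) ^ 2"
        by (simp add: power2_eq_square algebra_simps)
      then show "4 * (2 * real n + 1) * (2 * real n + 3) / (real n + 1) ^ 2 \<le> 16"
        by (simp add: pos_divide_le_eq)
    qed (use nonneg[of n] in simp)
    finally show ?case using Suc.IH by simp
  qed
  then show "real (2 * n + 1) * real ((2 * n) choose n) ^ 2 \<le> 16 ^ n"
    by (simp add: a_def)
  have "16 ^ n \<le> 4 * real n * a n" if "1 \<le> n"
    using that
  proof (induction n rule: dec_induct)
    case base
    then show ?case by (simp add: a_def)
  next
    case (step n)
    have "16 ^ Suc n \<le> 64 * real n * a n" using step.IH by simp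
    also have "\<dots> \<le> 16 * (2 * real n + 1) ^ 2 / (real n + 1) * a n"
      using nonneg[of n]
      by (intro mult_right_mono) (auto simp: divide_simps power2_eq_square algebra_simps)
    also have "\<dots> = 4 * real (Suc n) * a (Suc n)"
      unfolding rec by (simp add: divide_simps) (simp add: power2_eq_square algebra_simps)
    finally show ?case .
  qed
  then show "1 \<le> n \<Longrightarrow> 16 ^ n \<le> 4 * real n * real ((2 * n) choose n) ^ 2"
    by (simp add: a_def)
qed

text \<open>By symmetry the two Pascal summands of \<open>(2 * n) choose n\<close> are equal, so the
  bounds for the central coefficient are halved.\<close>

lemma odd_central_binomial_bounds:
  assumes "1 \<le> n"
  shows "real ((2 * n - 1) choose n) \<le> 4 ^ n / (2 * sqrt (2 * real n))"
    and "4 ^ n / (4 * sqrt (real n)) \<le> real ((2 * n - 1) choose n)"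
proof -
  obtain i where i: "n = Suc i" using assms by (cases n) auto
  have "(2 * n) choose n = 2 * ((2 * n - 1) choose n)"
    using binomial_symmetric[of i "2 * i + 1"] by (simp add: i)
  then have eq: "real ((2 * n) choose n) = 2 * real ((2 * n - 1) choose n)" by simp
  have pow: "(16::real) ^ n = (4 ^ n) ^ 2" by (simp add: power2_eq_square flip: power_mult_distrib)
  have "(real ((2 * n) choose n) * sqrt (2 * real n)) ^ 2 \<le> (4 ^ n) ^ 2"
  proof -
    have "(real ((2 * n) choose n) * sqrt (2 * real n)) ^ 2 = real (2 * n) * real ((2 * n) choose n) ^ 2"
      by (simp add: power_mult_distrib)
    also have "\<dots> \<le> real (2 * n + 1) * real ((2 * n) choose n) ^ 2"
      by (intro mult_right_mono) auto
    also have "\<dots> \<le> (4 ^ n) ^ 2"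
      unfolding pow[symmetric] by (rule central_binomial_square_bounds(1))
    finally show ?thesis .
  qed
  then have "real ((2 * n) choose n) * sqrt (2 * real n) \<le> 4 ^ n"
    by (rule power2_le_imp_le) simp
  then show "real ((2 * n - 1) choose n) \<le> 4 ^ n / (2 * sqrt (2 * real n))"
    using assms unfolding eq by (simp add: field_simps)
  have "(4 ^ n) ^ 2 \<le> (2 * sqrt (real n) * real ((2 * n) choose n)) ^ 2"
    using central_binomial_square_bounds(2)[OF assms] pow by (simp add: power_mult_distrib)
  then have "4 ^ n \<le> 2 * sqrt (real n) * real ((2 * n) choose n)"
    by (rule power2_le_imp_le) simp
  then show "4 ^ n / (4 * sqrt (real n)) \<le> real ((2 * n - 1) choose n)"
    using assms unfolding eq by (simp add: field_simps)
qed

text \<open>The range of \<open>k\<close> covers both \<open>k = 2 * n - 1\<close> and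
  \<open>k = 2 * n\<close>, hence both parities in (i).\<close>

lemma odd_central_binomial_ge:
  assumes "1 \<le> n" "n \<le> k" "k \<le> 2 * n"
  shows "1 / 4 * (2 ^ k / sqrt (real k)) \<le> real ((2 * n - 1) choose n)"
proof -
  have "(2::real) ^ k \<le> 2 ^ (2 * n)" using assms by (intro power_increasing) auto
  also have "\<dots> = 4 ^ n" by (simp add: power_mult)
  finally have "2 ^ k / sqrt (real k) \<le> 4 ^ n / sqrt (real n)"
    using assms by (intro frac_le) auto
  then show ?thesis using odd_central_binomial_bounds(2)[OF assms(1)] by (simp add: field_simps)
qed

text \<open>A single term of the exponential series is at most the sum; this replaces Stirling's
  formula.\<close>

lemma power_le_fact_mult_exp:
  fixes x :: real
  assumes "0 \<le> x"
  shows "x ^ n \<le> fact n * exp x"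
proof -
  have "(\<lambda>i. x ^ i /\<^sub>R fact i) sums exp x" by (rule exp_converges)
  then have "(\<Sum>i\<in>{n}. x ^ i /\<^sub>R fact i) \<le> exp x"
    using assms sum_le_suminf[of "\<lambda>i. x ^ i /\<^sub>R fact i" "{n}"] by (simp add: sums_iff)
  then show ?thesis by (simp add: field_simps)
qed

lemma exp_one_le_3: "exp 1 \<le> (3::real)"
  using exp_bound[of 1] by simp

text \<open>Bernoulli for \<open>16 / 9 = 1 + 7 / 9\<close>. The 9 stems from
  \<open>exp 1 \<le> 3\<close> squared, the 16 from the square of \<open>4 ^ n\<close>.\<close>

lemma linear_times_9_power_le: "real n * 9 ^ n \<le> 2 * 16 ^ n"
proof -
  have "1 + real n * (7 / 9) \<le> (1 + 7 / 9) ^ n"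
    by (rule Bernoulli_inequality) simp
  then have "real n \<le> 2 * (16 / 9) ^ n" by simp
  then show ?thesis by (simp add: power_divide field_simps)
qed

lemma cycle_bound_asymptotics:
  fixes n k :: nat
  assumes "1 \<le> n"
  defines "f \<equiv> real ((2 * n - 1) choose n) * (real k / real (2 * n - 1)) ^ n"
    and "g \<equiv> (4 * real k / real (2 * n)) ^ n / sqrt (real (2 * n))"
  shows "f \<le> 3 / 2 * g" and "1 / 4 * g \<le> f"
    and "1 / 6 * sqrt (real (k choose (2 * n))) \<le> f"
proof -
  define x where "x = (real k / real (2 * n)) ^ n"
  have x: "0 \<le> x" by (simp add: x_def)
  have "4 * real k / real (2 * n) = 4 * (real k / real (2 * n))" by simp
  then have g: "g = 4 ^ n * x / sqrt (2 * real n)"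
    unfolding g_def x_def by (simp only: power_mult_distrib) simp
  have low: "4 ^ n / (4 * sqrt (real n)) * x \<le> f"
    unfolding f_def x_def
    using assms odd_central_binomial_bounds(2)[OF assms(1)]
    by (intro mult_mono power_mono frac_le) auto
  show "1 / 4 * g \<le> f"
  proof -
    have "4 ^ n * x / sqrt (2 * real n) \<le> 4 ^ n * x / sqrt (real n)"
      using assms x by (intro divide_left_mono) auto
    then have "1 / 4 * g \<le> 1 / 4 * (4 ^ n * x / sqrt (real n))" by (simp add: g)
    also have "\<dots> = 4 ^ n / (4 * sqrt (real n)) * x" by simp
    finally show ?thesis using low by simp
  qed
  show "f \<le> 3 / 2 * g"
  proof -
    have pos: "0 < real (2 * n - 1)" using assms by simp
    \<comment> \<open>Replacing \<open>2 * n - 1\<close> by \<open>2 * n\<close> in the denominator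
      costs at most a factor \<open>exp 1 \<le> 3\<close>, which gives the constant
      \<open>3 / 2\<close>.\<close>
    have "(real (2 * n) / real (2 * n - 1)) ^ n = (1 + 1 / real (2 * n - 1)) ^ n"
      using assms pos by (simp add: field_simps of_nat_diff)
    also have "\<dots> \<le> exp (1 / real (2 * n - 1)) ^ n"
      by (intro power_mono exp_ge_add_one_self) auto
    also have "\<dots> = exp (real n / real (2 * n - 1))"
      by (simp flip: exp_of_nat_mult)
    also have "\<dots> \<le> exp 1"
      using assms pos by (simp add: field_simps of_nat_diff)
    also have "\<dots> \<le> 3" by (rule exp_one_le_3)
    finally have *: "(real (2 * n) / real (2 * n - 1)) ^ n \<le> 3" .
    have "(real k / real (2 * n - 1)) ^ n = x * (real (2 * n) / real (2 * n - 1)) ^ n"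
      using assms by (simp add: x_def flip: power_mult_distrib)
    also have "\<dots> \<le> x * 3" using * x by (intro mult_left_mono)
    finally have "f \<le> 4 ^ n / (2 * sqrt (2 * real n)) * (x * 3)"
      unfolding f_def using odd_central_binomial_bounds(1)[OF assms(1)] by (intro mult_mono) auto
    then show ?thesis by (simp add: g field_simps)
  qed
  show "1 / 6 * sqrt (real (k choose (2 * n))) \<le> f"
  proof -
    have xx: "x ^ 2 = real k ^ (2 * n) / real (2 * n) ^ (2 * n)"
      by (simp only: x_def power_divide power_mult[symmetric] mult.commute)
    have "real (2 * n) ^ (2 * n) \<le> fact (2 * n) * exp (real (2 * n))"
      by (rule power_le_fact_mult_exp) simp
    also have "exp (real (2 * n)) = exp 1 ^ (2 * n)" by (simp flip: exp_of_nat_mult)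
    also have "fact (2 * n) * exp 1 ^ (2 * n) \<le> fact (2 * n) * (3::real) ^ (2 * n)"
      by (intro mult_left_mono power_mono exp_one_le_3) auto
    also have "(3::real) ^ (2 * n) = 9 ^ n" by (simp add: power_mult)
    finally have fact: "real (2 * n) ^ (2 * n) \<le> fact (2 * n) * 9 ^ n" .
    have "real ((k choose (2 * n)) * fact (2 * n)) \<le> real (k ^ (2 * n))"
      by (intro of_nat_mono binomial_fact_pow)
    then have "real (k choose (2 * n)) * (fact (2 * n) * 9 ^ n) \<le> real k ^ (2 * n) * 9 ^ n"
      by simp
    moreover have "real (k choose (2 * n)) * real (2 * n) ^ (2 * n)
        \<le> real (k choose (2 * n)) * (fact (2 * n) * 9 ^ n)"
      using fact by (intro mult_left_mono) auto
    ultimately have "real (k choose (2 * n)) * real (2 * n) ^ (2 * n) \<le> real k ^ (2 * n) * 9 ^ n"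
      by linarith
    then have "real (k choose (2 * n)) \<le> x ^ 2 * 9 ^ n"
      using assms unfolding xx by (simp add: field_simps)
    \<comment> \<open>The lower bound \<open>low\<close> loses a factor \<open>n\<close> when
      squared; the gap between \<open>9 ^ n\<close> and \<open>16 ^ n\<close> pays for it.\<close>
    then have "real n * real (k choose (2 * n)) \<le> real n * (x ^ 2 * 9 ^ n)"
      by (intro mult_left_mono) auto
    also have "\<dots> = x ^ 2 * (real n * 9 ^ n)" by simp
    also have "\<dots> \<le> x ^ 2 * (2 * 16 ^ n)"
      by (intro mult_left_mono linear_times_9_power_le) auto
    finally have choose: "real n * real (k choose (2 * n)) \<le> x ^ 2 * (2 * 16 ^ n)" .
    \<comment> \<open>The comparison requires \<open>2 * 16 = 32 \<le> 36\<close>, hence the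
      constant \<open>1 / 6\<close>.\<close>
    have "(1 / 6 * sqrt (real (k choose (2 * n)))) ^ 2 = real (k choose (2 * n)) / 36"
      by (simp add: power_mult_distrib power_divide)
    also have "\<dots> \<le> 16 ^ n * x ^ 2 / (16 * real n)"
    proof -
      define y where "y = 16 ^ n * x ^ 2"
      have "0 \<le> y" "real n * real (k choose (2 * n)) \<le> 2 * y"
        using choose by (simp_all add: y_def mult_ac)
      then have "real n * (16 * real (k choose (2 * n))) \<le> 36 * y" by linarith
      then have "real (k choose (2 * n)) / 36 \<le> y / (16 * real n)"
        using assms(1) by (simp add: field_simps)
      then show ?thesis by (simp only: y_def)
    qed
    also have "\<dots> = (4 ^ n / (4 * sqrt (real n)) * x) ^ 2"
    proof -
      have "(16::real) ^ n = (4 ^ n) ^ 2" by (simp add: power2_eq_square flip: power_mult_distrib)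
      then show ?thesis by (simp add: power_mult_distrib power_divide)
    qed
    finally have "(1 / 6 * sqrt (real (k choose (2 * n)))) ^ 2 \<le> (4 ^ n / (4 * sqrt (real n)) * x) ^ 2" .
    then have "1 / 6 * sqrt (real (k choose (2 * n))) \<le> 4 ^ n / (4 * sqrt (real n)) * x"
      by (rule power2_le_imp_le) (use x in simp)
    then show ?thesis using low by linarith
  qed
qed

section \<open>Assembling the bounds\<close>

text \<open>\<open>m < k\<close> rules out \<open>j = 1\<close>, where \<open>k = m - 1\<close>, so
  the cycles have length at least 3.\<close>

lemma admissibleE:
  assumes "(m, k) \<in> admissible"
  obtains n j where "m = 2 * n" "1 \<le> n" "odd j" "1 < j" "k = j * (2 * n - 1)"
proof -
  obtain n where n: "m = 2 * n" using assms by (auto simp: admissible_def elim: evenE)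
  obtain j where j: "odd j" "k = j * (m - 1)" "m < k" "2 \<le> m"
    using assms by (auto simp: admissible_def)
  have "j \<noteq> 1" using j by auto
  moreover have "j \<noteq> 0" using j(1) by (cases j) auto
  ultimately show ?thesis using that[of n j] n j by auto
qed

text \<open>Over a principal filter the Landau symbols are uniform: one constant serves all odd
  \<open>k\<close>, or all admissible pairs.\<close>

theorem theorem2:
  shows
    "((\<forall>k. odd k \<longrightarrow>
         ereal (real (k choose ((k + 1) div 2))) \<le> det_ratio k (one_out_of ((k + 1) div 2) k)) \<and>
      (\<lambda>k. real (k choose ((k + 1) div 2))) \<in> \<Omega>[principal {k. odd k}](\<lambda>k. 2 ^ k / sqrt (real k)) \<and>
      (\<exists>c>0. \<forall>k\<ge>1.
         ereal (c * (2 ^ k / sqrt (real k))) \<le> det_ratio k (one_out_of ((k + 1) div 2) k)))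
     \<and>
     ((\<forall>(m, k)\<in>admissible.
         ereal (real ((m - 1) choose (m div 2)) * (real k / real (m - 1)) ^ (m div 2))
           \<le> det_ratio k (one_out_of m k)) \<and>
      (\<lambda>(m, k). real ((m - 1) choose (m div 2)) * (real k / real (m - 1)) ^ (m div 2))
         \<in> \<Theta>[principal admissible](\<lambda>(m, k). (4 * real k / real m) ^ (m div 2) / sqrt (real m)) \<and>
      (\<lambda>(m, k). real ((m - 1) choose (m div 2)) * (real k / real (m - 1)) ^ (m div 2))
         \<in> \<Omega>[principal admissible](\<lambda>(m, k). sqrt (real (card (one_out_of m k)))))"
    (is "(?A1 \<and> ?A2 \<and> ?A3) \<and> (?B1 \<and> ?f \<in> \<Theta>[principal admissible](?g) \<and> ?f \<in> \<Omega>[principal admissible](?h))")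
proof -
  have half: "k = 2 * ((k + 1) div 2) - 1" "1 \<le> (k + 1) div 2" if "odd k" for k :: nat
    using that by (auto elim!: oddE)
  have ?A1
    using binomial_le_det_ratio half by (metis order_refl)
  moreover have ?A2
  proof (rule landau_omega.bigI[of "1 / 4"])
    show "\<forall>\<^sub>F k in principal {k. odd k}.
        norm (real (k choose ((k + 1) div 2))) \<ge> 1 / 4 * norm (2 ^ k / sqrt (real k) :: real)"
      unfolding eventually_principal
    proof clarify
      fix k :: nat assume k: "odd k"
      have "1 / 4 * (2 ^ k / sqrt (real k)) \<le> real ((2 * ((k + 1) div 2) - 1) choose ((k + 1) div 2))"
        using half[OF k] by (intro odd_central_binomial_ge) linarith+
      then show "norm (real (k choose ((k + 1) div 2))) \<ge> 1 / 4 * norm (2 ^ k / sqrt (real k) :: real)"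
        using half(1)[OF k] by simp
    qed
  qed simp
  moreover have ?A3
  proof (intro exI[of _ "1 / 4"] conjI allI impI)
    fix k :: nat assume k: "1 \<le> k"
    let ?n = "(k + 1) div 2"
    have "ereal (1 / 4 * (2 ^ k / sqrt (real k))) \<le> ereal (real ((2 * ?n - 1) choose ?n))"
      using k odd_central_binomial_ge[of ?n k] by simp
    also have "\<dots> \<le> det_ratio k (one_out_of ?n k)"
      using k by (intro binomial_le_det_ratio) linarith+
    finally show "ereal (1 / 4 * (2 ^ k / sqrt (real k))) \<le> det_ratio k (one_out_of ?n k)" .
  qed simp
  moreover have ?B1
  proof clarify
    fix m k assume "(m, k) \<in> admissible"
    then obtain n j where nj: "m = 2 * n" "1 \<le> n" "odd j" "1 < j" "k = j * (2 * n - 1)"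
      by (rule admissibleE)
    have "real k / real (2 * n - 1) = real j" using nj by simp
    then show "ereal (real ((m - 1) choose (m div 2)) * (real k / real (m - 1)) ^ (m div 2))
           \<le> det_ratio k (one_out_of m k)"
      using cycle_union_le_det_ratio[OF nj(3,4,2,5)] nj(1) by simp
  qed
  moreover have bounds: "0 \<le> ?f p \<and> 0 \<le> ?g p \<and> ?f p \<le> 3 / 2 * ?g p \<and> 1 / 4 * ?g p \<le> ?f p \<and>
      1 / 6 * ?h p \<le> ?f p \<and> 0 \<le> ?h p" if "p \<in> admissible" for p
  proof -
    obtain m k where p: "p = (m, k)" by (cases p)
    obtain n where n: "m = 2 * n" "1 \<le> n"
      using \<open>p \<in> admissible\<close> admissibleE unfolding p by metis
    have "card (one_out_of m k) = k choose m"
      by (simp add: one_out_of_def n_subsets)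
    then show ?thesis
      using cycle_bound_asymptotics[OF n(2), of k] by (simp add: p n(1))
  qed
  moreover have "?f \<in> \<Theta>[principal admissible](?g)"
  proof (rule bigthetaI'[of "1 / 4" "3 / 2"])
    show "\<forall>\<^sub>F p in principal admissible. 1 / 4 * norm (?g p) \<le> norm (?f p) \<and> norm (?f p) \<le> 3 / 2 * norm (?g p)"
      unfolding eventually_principal
    proof
      fix p assume "p \<in> admissible"
      from bounds[OF this] show "1 / 4 * norm (?g p) \<le> norm (?f p) \<and> norm (?f p) \<le> 3 / 2 * norm (?g p)"
        by (simp only: real_norm_def abs_of_nonneg)
    qed
  qed auto
  moreover have "?f \<in> \<Omega>[principal admissible](?h)"
  proof (rule landau_omega.bigI[of "1 / 6"])
    show "\<forall>\<^sub>F p in principal admissible. norm (?f p) \<ge> 1 / 6 * norm (?h p)"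
      unfolding eventually_principal
    proof
      fix p assume "p \<in> admissible"
      from bounds[OF this] show "norm (?f p) \<ge> 1 / 6 * norm (?h p)"
        by (simp only: real_norm_def abs_of_nonneg)
    qed
  qed simp
  ultimately show ?thesis by blast
qed

end
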